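(* Compensated summation of real numbers $x_1,\ldots,x_n$ has the first order error $$e_n=\hat{s}_n-s_n=s_n\sigma_n+x_n\eta_n+\sum_{j=2}^{n-1}x_j(\eta_j-\delta_j)+\mathcal{O}(u^2),$$ with the bound $$|\hat{s}_n-s_n|\le 3u\sum_{j=1}^n|x_j|+\mathcal{O}(u^2).$$
   Context: Let $x_1,\ldots,x_n$ be real numbers ($n\ge 2$), $s_k=\sum_{j=1}^k x_j$ the exact partial sums, and $0<u<1$ the unit roundoff. The finite precision model of compensated (Kahan) summation is $$\hat{s}_1=s_1=x_1,\qquad\hat{c}_1=0,$$ and for $2\le k\le n$ $$\hat{y}_k=(x_k-\hat{c}_{k-1})(1+\eta_k),\quad \hat{s}_k=(\hat{s}_{k-1}+\hat{y}_k)(1+\sigma_k),\quad \hat{c}_k=\bigl((\hat{s}_k-\hat{s}_{k-1})(1+\delta_k)-\hat{y}_k\bigr)(1+\beta_k),$$ with $\eta_2=0$ and $|\eta_k|,|\sigma_k|,|\delta_k|,|\beta_k|\le u$. The notation $\mathcal{O}(u^2)$ is as $u\to0$, with constant depending only on $n$ and $x_1,\ldots,x_n$, uniformly over all roundoffs bounded by $u$. *)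

theory Defs
  imports Complex_Main "HOL-Library.Landau_Symbols"
begin

text \<open>
  Sequences are indexed from 1 as in the usual notation; values at indices outside
  \<open>{1..n}\<close> (outside \<open>{2..n}\<close> for the roundoffs and for \<open>yh\<close>) are irrelevant.
  The sequences \<open>yh\<close>, \<open>sh\<close>, \<open>ch\<close> are the computed quantities with hats; they are
  determined on these ranges by \<open>x\<close> and the roundoffs \<open>\<eta>\<close>, \<open>\<sigma>\<close>, \<open>\<delta>\<close>, \<open>\<beta>\<close>.
\<close>

definition roundoffs ::
  "nat \<Rightarrow> real \<Rightarrow> (nat \<Rightarrow> real) \<Rightarrow> (nat \<Rightarrow> real) \<Rightarrow> (nat \<Rightarrow> real) \<Rightarrow> (nat \<Rightarrow> real) \<Rightarrow> bool" where
  "roundoffs n u \<eta> \<sigma> \<delta> \<beta> \<longleftrightarrow>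
     \<eta> 2 = 0 \<and>
     (\<forall>k\<in>{2..n}. \<bar>\<eta> k\<bar> \<le> u \<and> \<bar>\<sigma> k\<bar> \<le> u \<and> \<bar>\<delta> k\<bar> \<le> u \<and> \<bar>\<beta> k\<bar> \<le> u)"

definition compensated_sum ::
  "nat \<Rightarrow> (nat \<Rightarrow> real) \<Rightarrow>
   (nat \<Rightarrow> real) \<Rightarrow> (nat \<Rightarrow> real) \<Rightarrow> (nat \<Rightarrow> real) \<Rightarrow> (nat \<Rightarrow> real) \<Rightarrow>
   (nat \<Rightarrow> real) \<Rightarrow> (nat \<Rightarrow> real) \<Rightarrow> (nat \<Rightarrow> real) \<Rightarrow> bool" where
  "compensated_sum n x \<eta> \<sigma> \<delta> \<beta> yh sh ch \<longleftrightarrow>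
     sh 1 = x 1 \<and> ch 1 = 0 \<and>
     (\<forall>k\<in>{2..n}.
        yh k = (x k - ch (k - 1)) * (1 + \<eta> k) \<and>
        sh k = (sh (k - 1) + yh k) * (1 + \<sigma> k) \<and>
        ch k = ((sh k - sh (k - 1)) * (1 + \<delta> k) - yh k) * (1 + \<beta> k))"

definition partial_sum :: "(nat \<Rightarrow> real) \<Rightarrow> nat \<Rightarrow> real" where
  "partial_sum x k = (\<Sum>j=1..k. x j)"

end

theory Submission
  imports Defs
begin

text \<open>
  Write \<open>e k\<close> for the error \<open>sh k - s k\<close> of the computed partial sum. The correction \<open>ch k\<close> is
  meant to capture the rounding error of the most recent addition, so the natural quantity to
  follow is \<open>d k = e k - ch k\<close>, the error that remains once the correction has been applied.
  The large contribution \<open>s k * \<sigma> k\<close> occurs to first order both in \<open>e k\<close> and in \<open>ch k\<close>, and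
  cancels in the difference:
  \<open>d k = d (k - 1) + x k * (\<eta> k - \<delta> k) + O(u\<^sup>2)\<close>.
  Summing up, \<open>d k\<close> is the sum of \<open>x j * (\<eta> j - \<delta> j)\<close> over \<open>j = 2..k\<close> up to \<open>O(u\<^sup>2)\<close>. In
  the last step no later correction removes \<open>\<sigma> n\<close>, and \<open>\<delta> n\<close> affects only the correction:
  \<open>e n = d (n - 1) + x n * \<eta> n + s n * \<sigma> n + O(u\<^sup>2)\<close>, which is the claimed expansion.

  To keep the second order terms uniform in the roundoffs, the argument carries explicit
  constants. With \<open>X\<close> the sum of the \<open>\<bar>x j\<bar>\<close>, the induction
  \<open>residual_error_invariant\<close> shows that both \<open>\<bar>ch k\<bar> / u\<close> and the second order part of \<open>d k\<close>
  divided by \<open>u\<^sup>2\<close> are at most \<open>32 ^ k * X\<close>. Each step replaces a constant \<open>C\<close> by at most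
  \<open>20 * X + 12 * C\<close> (\<open>compensated_step_bounds\<close>), which is at most \<open>32 * C\<close> when \<open>X \<le> C\<close>.
\<close>

section \<open>One step of compensated summation\<close>

lemma abs_mult_le:
  fixes a b A B :: real
  assumes "\<bar>a\<bar> \<le> A" "\<bar>b\<bar> \<le> B"
  shows "\<bar>a * b\<bar> \<le> A * B"
  unfolding abs_mult using assms by (intro mult_mono) auto

lemma partial_sum_rec:
  assumes "k \<ge> 2"
  shows "partial_sum x k = partial_sum x (k - 1) + x k"
proof -
  from assms obtain m where "k = Suc m" by (cases k) auto
  then show ?thesis by (simp add: partial_sum_def)
qed

text \<open>
  The recurrence in terms of the residual error \<open>d\<close>. Here \<open>p\<close> is \<open>sh (k - 1) + yh k\<close>, the
  value that is rounded in the main addition; up to the factor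
  \<open>1 + \<eta> k\<close>, the old sum and the old correction enter it only through their difference, hence
  through \<open>d\<close>. The rounding error of that addition
  is \<open>p * \<sigma> k\<close>, and for \<open>\<delta> k = \<beta> k = 0\<close> the correction recovers it exactly.
\<close>

lemma compensated_sum_step:
  fixes x :: "nat \<Rightarrow> real"
  assumes run: "compensated_sum n x \<eta> \<sigma> \<delta> \<beta> yh sh ch" and k: "k \<in> {2..n}"
    and d: "d = sh (k - 1) - partial_sum x (k - 1) - ch (k - 1)"
    and p: "p = partial_sum x k + d + (x k - ch (k - 1)) * \<eta> k"
    and y: "y = (x k - ch (k - 1)) * (1 + \<eta> k)"
  shows "sh k - partial_sum x k = d + (x k - ch (k - 1)) * \<eta> k + p * \<sigma> k"
    and "ch k = (y * \<delta> k + p * \<sigma> k * (1 + \<delta> k)) * (1 + \<beta> k)"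
proof -
  have yh: "yh k = y" and sh: "sh k = (sh (k - 1) + yh k) * (1 + \<sigma> k)"
    and ch: "ch k = ((sh k - sh (k - 1)) * (1 + \<delta> k) - yh k) * (1 + \<beta> k)"
    using run k unfolding compensated_sum_def y by auto
  have p': "sh (k - 1) + y = p"
    using partial_sum_rec[of k x] k unfolding p d y by (simp add: algebra_simps)
  then have sh': "sh k = p * (1 + \<sigma> k)" using sh yh by simp
  then show "sh k - partial_sum x k = d + (x k - ch (k - 1)) * \<eta> k + p * \<sigma> k"
    by (simp add: p algebra_simps)
  have diff: "sh k - sh (k - 1) = y + p * \<sigma> k"
    using sh' p' by (simp add: algebra_simps)
  show "ch k = (y * \<delta> k + p * \<sigma> k * (1 + \<delta> k)) * (1 + \<beta> k)"
    unfolding ch yh diff by (simp add: algebra_simps)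
qed

text \<open>
  One step of the recurrence, with the new correction and the new error written out. The last
  claim is where the compensation happens: \<open>p * \<sigma>\<close> is part of both the error and the
  correction, so every term left after subtraction contains two factors of size \<open>u\<close>.
\<close>

lemma compensated_step_bounds:
  fixes u X C s c d x \<eta> \<sigma> \<delta> \<beta> :: real
  assumes u: "0 < u" "u < 1"
    and eta: "\<bar>\<eta>\<bar> \<le> u" and sigma: "\<bar>\<sigma>\<bar> \<le> u" and delta: "\<bar>\<delta>\<bar> \<le> u" and beta: "\<bar>\<beta>\<bar> \<le> u"
    and X: "\<bar>x\<bar> \<le> X" "\<bar>s\<bar> \<le> X" and C: "0 \<le> C"
    and c: "\<bar>c\<bar> \<le> C * u" and d: "\<bar>d\<bar> \<le> (C + 2 * X) * u"
    and p: "p = s + d + (x - c) * \<eta>" and y: "y = (x - c) * (1 + \<eta>)"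
    and c': "c' = (y * \<delta> + p * \<sigma> * (1 + \<delta>)) * (1 + \<beta>)"
  shows "\<bar>(d + (x - c) * \<eta> + p * \<sigma>) - (d + s * \<sigma> + x * \<eta>)\<bar> \<le> (3 * X + 3 * C) * u\<^sup>2"
    and "\<bar>c'\<bar> \<le> (20 * X + 12 * C) * u"
    and "\<bar>(d + (x - c) * \<eta> + p * \<sigma> - c') - (d + x * (\<eta> - \<delta>))\<bar> \<le> (15 * X + 11 * C) * u\<^sup>2"
proof -
  have X0: "0 \<le> X" using X by linarith
  have "C * u \<le> C" using u C by (simp add: mult_left_le)
  with c X have xc: "\<bar>x - c\<bar> \<le> X + C" by linarith
  have xc_eta: "\<bar>(x - c) * \<eta>\<bar> \<le> (X + C) * u"
    by (rule abs_mult_le[OF xc eta])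
  have "\<bar>d + (x - c) * \<eta>\<bar> \<le> (C + 2 * X) * u + (X + C) * u"
    using d xc_eta by linarith
  then have shift: "\<bar>d + (x - c) * \<eta>\<bar> \<le> (3 * X + 2 * C) * u" by (simp add: algebra_simps)
  have "(3 * X + 2 * C) * u \<le> 3 * X + 2 * C" using u C X0 by (simp add: mult_left_le)
  with shift X have P: "\<bar>p\<bar> \<le> 4 * X + 2 * C" unfolding p by linarith
  have one_plus: "\<bar>1 + r\<bar> \<le> 2" if "\<bar>r\<bar> \<le> u" for r :: real using that u by linarith
  have Y: "\<bar>y\<bar> \<le> (X + C) * 2" unfolding y by (rule abs_mult_le[OF xc one_plus[OF eta]])
  have ps: "\<bar>p * \<sigma>\<bar> \<le> (4 * X + 2 * C) * u" by (rule abs_mult_le[OF P sigma])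
  define q where "q = y * \<delta> + p * \<sigma> * (1 + \<delta>)"
  have "\<bar>q\<bar> \<le> (X + C) * 2 * u + (4 * X + 2 * C) * u * 2"
    unfolding q_def
    using abs_mult_le[OF Y delta] abs_mult_le[OF ps one_plus[OF delta]] by linarith
  then have q: "\<bar>q\<bar> \<le> (10 * X + 6 * C) * u" by (simp add: algebra_simps)
  have c'q: "c' = q * (1 + \<beta>)" by (simp add: c' q_def)
  show "\<bar>c'\<bar> \<le> (20 * X + 12 * C) * u"
    using abs_mult_le[OF q one_plus[OF beta]] unfolding c'q by (simp add: algebra_simps)
  have ce: "\<bar>c * \<eta>\<bar> \<le> C * u * u" by (rule abs_mult_le[OF c eta])
  have "(d + (x - c) * \<eta> + p * \<sigma>) - (d + s * \<sigma> + x * \<eta>) = (d + (x - c) * \<eta>) * \<sigma> - c * \<eta>"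
    by (simp add: p algebra_simps)
  then have "\<bar>(d + (x - c) * \<eta> + p * \<sigma>) - (d + s * \<sigma> + x * \<eta>)\<bar>
      \<le> (3 * X + 2 * C) * u * u + C * u * u"
    using abs_mult_le[OF shift sigma] ce by linarith
  then show "\<bar>(d + (x - c) * \<eta> + p * \<sigma>) - (d + s * \<sigma> + x * \<eta>)\<bar> \<le> (3 * X + 3 * C) * u\<^sup>2"
    by (simp add: algebra_simps power2_eq_square)
  have "(d + (x - c) * \<eta> + p * \<sigma> - c') - (d + x * (\<eta> - \<delta>))
      = - (c * \<eta>) + c * \<delta> - (x - c) * \<eta> * \<delta> - p * \<sigma> * \<delta> - q * \<beta>"
    by (simp add: c'q q_def y algebra_simps)
  then have "\<bar>(d + (x - c) * \<eta> + p * \<sigma> - c') - (d + x * (\<eta> - \<delta>))\<bar>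
      \<le> C * u * u + C * u * u + (X + C) * u * u + (4 * X + 2 * C) * u * u
        + (10 * X + 6 * C) * u * u"
    using ce abs_mult_le[OF c delta] abs_mult_le[OF xc_eta delta]
      abs_mult_le[OF ps delta] abs_mult_le[OF q beta] by linarith
  then show "\<bar>(d + (x - c) * \<eta> + p * \<sigma> - c') - (d + x * (\<eta> - \<delta>))\<bar> \<le> (15 * X + 11 * C) * u\<^sup>2"
    by (simp add: algebra_simps power2_eq_square)
qed

section \<open>Propagation of the residual error\<close>

lemma abs_partial_sum_le:
  assumes "k \<le> n"
  shows "\<bar>partial_sum x k\<bar> \<le> (\<Sum>j=1..n. \<bar>x j\<bar>)"
proof -
  have "\<bar>partial_sum x k\<bar> \<le> (\<Sum>j=1..k. \<bar>x j\<bar>)"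
    unfolding partial_sum_def by (rule sum_abs)
  also have "\<dots> \<le> (\<Sum>j=1..n. \<bar>x j\<bar>)"
    using assms by (intro sum_mono2) auto
  finally show ?thesis .
qed

lemma abs_roundoff_sum_le:
  assumes "roundoffs n u \<eta> \<sigma> \<delta> \<beta>" "k \<le> n"
  shows "\<bar>\<Sum>j=2..k. x j * (\<eta> j - \<delta> j)\<bar> \<le> 2 * u * (\<Sum>j=2..k. \<bar>x j\<bar>)"
proof -
  have "\<bar>x j * (\<eta> j - \<delta> j)\<bar> \<le> \<bar>x j\<bar> * (2 * u)" if "j \<in> {2..k}" for j
  proof (rule abs_mult_le)
    have "j \<in> {2..n}" using that assms(2) by auto
    then have "\<bar>\<eta> j\<bar> \<le> u" "\<bar>\<delta> j\<bar> \<le> u" using assms(1) by (auto simp: roundoffs_def)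
    then show "\<bar>\<eta> j - \<delta> j\<bar> \<le> 2 * u" by linarith
  qed simp
  then have "\<bar>\<Sum>j=2..k. x j * (\<eta> j - \<delta> j)\<bar> \<le> (\<Sum>j=2..k. \<bar>x j\<bar> * (2 * u))"
    by (intro order_trans[OF sum_abs] sum_mono)
  also have "\<dots> = 2 * u * (\<Sum>j=2..k. \<bar>x j\<bar>)"
    by (simp add: sum_distrib_left mult_ac)
  finally show ?thesis .
qed

text \<open>
  A residual error within \<open>C * u\<^sup>2\<close> of its first order part is itself of size \<open>u\<close>, which is
  the form in which it enters the next step.
\<close>

lemma abs_residual_error_le:
  fixes d :: real
  assumes u: "0 < u" "u < 1" and ro: "roundoffs n u \<eta> \<sigma> \<delta> \<beta>" and k: "k \<le> n" and C: "0 \<le> C"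
    and d: "\<bar>d - (\<Sum>j=2..k. x j * (\<eta> j - \<delta> j))\<bar> \<le> C * u\<^sup>2"
  shows "\<bar>d\<bar> \<le> (C + 2 * (\<Sum>j=1..n. \<bar>x j\<bar>)) * u"
proof -
  have "(\<Sum>j=2..k. \<bar>x j\<bar>) \<le> (\<Sum>j=1..n. \<bar>x j\<bar>)"
    using k by (intro sum_mono2) auto
  then have "2 * u * (\<Sum>j=2..k. \<bar>x j\<bar>) \<le> 2 * u * (\<Sum>j=1..n. \<bar>x j\<bar>)"
    using u by (intro mult_left_mono) auto
  moreover have "C * u\<^sup>2 \<le> C * u"
    using u C by (intro mult_left_mono) (auto simp: power2_eq_square mult_left_le)
  ultimately have "\<bar>d\<bar> \<le> C * u + 2 * u * (\<Sum>j=1..n. \<bar>x j\<bar>)"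
    using d abs_roundoff_sum_le[OF ro k, of x] by linarith
  then show ?thesis by (simp add: algebra_simps)
qed

lemma residual_error_invariant:
  fixes x :: "nat \<Rightarrow> real"
  assumes u: "0 < u" "u < 1" and ro: "roundoffs n u \<eta> \<sigma> \<delta> \<beta>"
    and run: "compensated_sum n x \<eta> \<sigma> \<delta> \<beta> yh sh ch"
    and k: "1 \<le> k" "k \<le> n"
  defines "X \<equiv> \<Sum>j=1..n. \<bar>x j\<bar>"
  shows "\<bar>ch k\<bar> \<le> 32 ^ k * X * u \<and>
    \<bar>(sh k - partial_sum x k - ch k) - (\<Sum>j=2..k. x j * (\<eta> j - \<delta> j))\<bar> \<le> 32 ^ k * X * u\<^sup>2"
  using k
proof (induction k rule: dec_induct)
  case base
  have "0 \<le> X" unfolding X_def by (intro sum_nonneg) auto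
  then show ?case using run u by (simp add: compensated_sum_def partial_sum_def)
next
  case (step m)
  let ?C = "32 ^ m * X" and ?k = "Suc m"
  let ?d = "sh m - partial_sum x m - ch m"
  let ?p = "partial_sum x ?k + ?d + (x ?k - ch m) * \<eta> ?k"
  let ?y = "(x ?k - ch m) * (1 + \<eta> ?k)"
  have X0: "0 \<le> X" unfolding X_def by (intro sum_nonneg) auto
  have C0: "0 \<le> ?C" using X0 by simp
  have kn: "?k \<in> {2..n}" using step by auto
  have r: "\<bar>\<eta> ?k\<bar> \<le> u" "\<bar>\<sigma> ?k\<bar> \<le> u" "\<bar>\<delta> ?k\<bar> \<le> u" "\<bar>\<beta> ?k\<bar> \<le> u"
    using ro kn by (auto simp: roundoffs_def)
  have c: "\<bar>ch m\<bar> \<le> ?C * u"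
    and def: "\<bar>?d - (\<Sum>j=2..m. x j * (\<eta> j - \<delta> j))\<bar> \<le> ?C * u\<^sup>2"
    using step by auto
  have d: "\<bar>?d\<bar> \<le> (?C + 2 * X) * u"
    using abs_residual_error_le[OF u ro _ C0 def] step unfolding X_def by simp
  have xX: "\<bar>x ?k\<bar> \<le> X"
    unfolding X_def using kn by (intro member_le_sum) auto
  have sX: "\<bar>partial_sum x ?k\<bar> \<le> X"
    unfolding X_def using kn by (intro abs_partial_sum_le) auto
  note exact = compensated_sum_step[OF run kn refl refl refl, simplified]
  note bounds = compensated_step_bounds[OF u r xX sX C0 c d refl refl refl]
  have "1 * X \<le> ?C" using X0 by (intro mult_right_mono) auto
  moreover have "32 ^ ?k * X = 32 * ?C" by simp
  ultimately have CX: "20 * X + 12 * ?C \<le> 32 ^ ?k * X" "15 * X + 12 * ?C \<le> 32 ^ ?k * X"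
    using X0 by linarith+
  have "\<bar>ch ?k\<bar> \<le> (20 * X + 12 * ?C) * u"
    unfolding exact(2) by (rule bounds(2))
  also have "\<dots> \<le> 32 ^ ?k * X * u"
    using CX u by (intro mult_right_mono) auto
  finally have 1: "\<bar>ch ?k\<bar> \<le> 32 ^ ?k * X * u" .
  have "\<bar>(sh ?k - partial_sum x ?k - ch ?k) - (?d + x ?k * (\<eta> ?k - \<delta> ?k))\<bar>
      \<le> (15 * X + 11 * ?C) * u\<^sup>2"
    unfolding exact by (rule bounds(3))
  moreover have "(\<Sum>j=2..?k. x j * (\<eta> j - \<delta> j))
      = (\<Sum>j=2..m. x j * (\<eta> j - \<delta> j)) + x ?k * (\<eta> ?k - \<delta> ?k)"
    using step by simp
  ultimately have "\<bar>(sh ?k - partial_sum x ?k - ch ?k) - (\<Sum>j=2..?k. x j * (\<eta> j - \<delta> j))\<bar>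
      \<le> (15 * X + 11 * ?C) * u\<^sup>2 + ?C * u\<^sup>2"
    using def by linarith
  also have "\<dots> = (15 * X + 12 * ?C) * u\<^sup>2" by (simp add: algebra_simps)
  also have "\<dots> \<le> 32 ^ ?k * X * u\<^sup>2"
    using CX by (intro mult_right_mono) auto
  finally show ?case using 1 by simp
qed

section \<open>First order error of the computed sum\<close>

text \<open>
  The expansion of the error with an explicit second order term. The correction
  \<open>ch n\<close> is computed after \<open>sh n\<close>, so the last step starts from the residual error at \<open>n - 1\<close>
  and keeps the full rounding error of the final addition.
\<close>

lemma compensated_sum_error_expansion:
  fixes x :: "nat \<Rightarrow> real"
  assumes n: "n \<ge> 2" and u: "0 < u" "u < 1" and ro: "roundoffs n u \<eta> \<sigma> \<delta> \<beta>"
    and run: "compensated_sum n x \<eta> \<sigma> \<delta> \<beta> yh sh ch"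
  shows "\<bar>(sh n - partial_sum x n) -
      (partial_sum x n * \<sigma> n + x n * \<eta> n + (\<Sum>j=2..n-1. x j * (\<eta> j - \<delta> j)))\<bar>
    \<le> 32 ^ n * (\<Sum>j=1..n. \<bar>x j\<bar>) * u\<^sup>2"
proof -
  define X where "X = (\<Sum>j=1..n. \<bar>x j\<bar>)"
  define C where "C = 32 ^ (n - 1) * X"
  define d where "d = sh (n - 1) - partial_sum x (n - 1) - ch (n - 1)"
  have X0: "0 \<le> X" unfolding X_def by (intro sum_nonneg) auto
  have C0: "0 \<le> C" using X0 unfolding C_def by simp
  have nn: "n \<in> {2..n}" using n by auto
  have r: "\<bar>\<eta> n\<bar> \<le> u" "\<bar>\<sigma> n\<bar> \<le> u" "\<bar>\<delta> n\<bar> \<le> u" "\<bar>\<beta> n\<bar> \<le> u"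
    using ro nn by (auto simp: roundoffs_def)
  have c: "\<bar>ch (n - 1)\<bar> \<le> C * u"
    and def: "\<bar>d - (\<Sum>j=2..n-1. x j * (\<eta> j - \<delta> j))\<bar> \<le> C * u\<^sup>2"
    using residual_error_invariant[OF u ro run, of "n - 1"] n
    unfolding C_def X_def d_def by auto
  have d: "\<bar>d\<bar> \<le> (C + 2 * X) * u"
    using abs_residual_error_le[OF u ro _ C0 def] unfolding X_def by simp
  have xX: "\<bar>x n\<bar> \<le> X"
    unfolding X_def using n by (intro member_le_sum) auto
  have sX: "\<bar>partial_sum x n\<bar> \<le> X"
    unfolding X_def by (intro abs_partial_sum_le) auto
  have "\<bar>(sh n - partial_sum x n) - (d + partial_sum x n * \<sigma> n + x n * \<eta> n)\<bar>
      \<le> (3 * X + 3 * C) * u\<^sup>2"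
    unfolding compensated_sum_step(1)[OF run nn d_def refl refl]
    by (rule compensated_step_bounds(1)[OF u r xX sX C0 c d refl refl refl])
  then have "\<bar>(sh n - partial_sum x n) -
      (partial_sum x n * \<sigma> n + x n * \<eta> n + (\<Sum>j=2..n-1. x j * (\<eta> j - \<delta> j)))\<bar>
      \<le> (3 * X + 3 * C) * u\<^sup>2 + C * u\<^sup>2"
    using def by linarith
  also have "\<dots> = (3 * X + 4 * C) * u\<^sup>2" by (simp add: algebra_simps)
  also have "\<dots> \<le> 32 ^ n * X * u\<^sup>2"
  proof (rule mult_right_mono)
    have "1 * X \<le> C" unfolding C_def using X0 by (intro mult_right_mono) auto
    moreover have "32 ^ n * X = 32 * C"
      unfolding C_def using n by (cases n) auto
    ultimately show "3 * X + 4 * C \<le> 32 ^ n * X" using X0 by linarith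
  qed simp
  finally show ?thesis unfolding X_def .
qed

text \<open>
  The factor 3 comes from a count: each \<open>\<bar>x j\<bar>\<close> is charged once for its share in
  \<open>partial_sum x n * \<sigma> n\<close> and at most twice, through \<open>\<eta> j\<close> and \<open>\<delta> j\<close>, for the
  remaining terms.
\<close>

lemma abs_first_order_error_le:
  fixes x :: "nat \<Rightarrow> real"
  assumes n: "n \<ge> 2" and u: "0 < u" and ro: "roundoffs n u \<eta> \<sigma> \<delta> \<beta>"
  shows "\<bar>partial_sum x n * \<sigma> n + x n * \<eta> n + (\<Sum>j=2..n-1. x j * (\<eta> j - \<delta> j))\<bar>
    \<le> 3 * u * (\<Sum>j=1..n. \<bar>x j\<bar>)"
proof -
  define X where "X = (\<Sum>j=1..n. \<bar>x j\<bar>)"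
  define Y where "Y = (\<Sum>j=2..n-1. \<bar>x j\<bar>)"
  have r: "\<bar>\<eta> n\<bar> \<le> u" "\<bar>\<sigma> n\<bar> \<le> u"
    using ro n by (auto simp: roundoffs_def)
  have sX: "\<bar>partial_sum x n\<bar> \<le> X"
    unfolding X_def by (intro abs_partial_sum_le) auto
  have a: "\<bar>partial_sum x n * \<sigma> n\<bar> \<le> X * u" by (rule abs_mult_le[OF sX r(2)])
  have b: "\<bar>x n * \<eta> n\<bar> \<le> \<bar>x n\<bar> * u" by (rule abs_mult_le[OF order_refl r(1)])
  have e: "\<bar>\<Sum>j=2..n-1. x j * (\<eta> j - \<delta> j)\<bar> \<le> 2 * u * Y"
    unfolding Y_def by (rule abs_roundoff_sum_le[OF ro]) simp
  have "Y + \<bar>x n\<bar> = (\<Sum>j=2..n. \<bar>x j\<bar>)"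
    unfolding Y_def using n by (cases n) auto
  also have "\<dots> \<le> X" unfolding X_def by (intro sum_mono2) auto
  finally have "2 * u * (Y + \<bar>x n\<bar>) \<le> 2 * u * X"
    using u by (intro mult_left_mono) auto
  moreover have "0 \<le> \<bar>x n\<bar> * u" using u by simp
  ultimately show ?thesis
    using a b e unfolding X_def[symmetric] by (simp add: algebra_simps)
qed

theorem corollary4p4:
  fixes n :: nat and x :: "nat \<Rightarrow> real"
  assumes "n \<ge> 2"
  shows "(\<exists>R. R \<in> O[at_right 0](\<lambda>u::real. u ^ 2) \<and>
           (\<forall>u \<eta> \<sigma> \<delta> \<beta> yh sh ch.
              0 < u \<longrightarrow> u < 1 \<longrightarrow> roundoffs n u \<eta> \<sigma> \<delta> \<beta> \<longrightarrow>
              compensated_sum n x \<eta> \<sigma> \<delta> \<beta> yh sh ch \<longrightarrow>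
              \<bar>(sh n - partial_sum x n) -
                (partial_sum x n * \<sigma> n + x n * \<eta> n + (\<Sum>j=2..n-1. x j * (\<eta> j - \<delta> j)))\<bar>
              \<le> (R u :: real)))
       \<and> (\<exists>R. R \<in> O[at_right 0](\<lambda>u::real. u ^ 2) \<and>
           (\<forall>u \<eta> \<sigma> \<delta> \<beta> yh sh ch.
              0 < u \<longrightarrow> u < 1 \<longrightarrow> roundoffs n u \<eta> \<sigma> \<delta> \<beta> \<longrightarrow>
              compensated_sum n x \<eta> \<sigma> \<delta> \<beta> yh sh ch \<longrightarrow>
              \<bar>sh n - partial_sum x n\<bar> \<le> 3 * u * (\<Sum>j=1..n. \<bar>x j\<bar>) + (R u :: real)))"
proof -
  let ?R = "\<lambda>u::real. 32 ^ n * (\<Sum>j=1..n. \<bar>x j\<bar>) * u ^ 2"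
  have R: "?R \<in> O[at_right 0](\<lambda>u::real. u ^ 2)" by simp
  show ?thesis
  proof (intro conjI exI[of _ ?R] R allI impI)
    fix u \<eta> \<sigma> \<delta> \<beta> yh sh ch
    assume u: "0 < u" "u < 1" and ro: "roundoffs n u \<eta> \<sigma> \<delta> \<beta>"
      and run: "compensated_sum n x \<eta> \<sigma> \<delta> \<beta> yh sh ch"
    note expansion = compensated_sum_error_expansion[OF assms u ro run]
    then show "\<bar>(sh n - partial_sum x n) -
        (partial_sum x n * \<sigma> n + x n * \<eta> n + (\<Sum>j=2..n-1. x j * (\<eta> j - \<delta> j)))\<bar> \<le> ?R u" .
    show "\<bar>sh n - partial_sum x n\<bar> \<le> 3 * u * (\<Sum>j=1..n. \<bar>x j\<bar>) + ?R u"
      using expansion abs_first_order_error_le[OF assms u(1) ro, of x] by linarith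
  qed
qed

end
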